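(* Let $f: X \to X$ be an injective pc-map, i.e. a pc-map that is injective over the union $X_1\cup\dots\cup X_N$ of its continuity pieces. Then $h_{top}(f) = 0$.
   Context: **pc-maps.** Let $X\subset\mathbb R$ be a compact interval with non-empty interior, with the topology induced from $\mathbb R$. A pc-map (piecewise continuous interval map) is a map $f:X\to X$ together with finitely many pairwise disjoint non-empty intervals $X_1,\dots,X_N\subset X$ ($N\ge1$), open in $X$ (the continuity pieces), such that $X=\overline{X_1}\cup\dots\cup\overline{X_N}$, each $f|_{X_i}$ is continuous, and $f$ has finitely many critical points (points where $f$ is not locally invertible or where $f$ is discontinuous) within each continuity piece. The pieces are sorted: if $i<j$ then $x<y$ for all $x\in X_i$, $y\in X_j$. Put $\Delta_f:=\bigcup_{i=1}^N\partial X_i$, where $\partial$ is the boundary within $X$. By convention $f$ is continuous at the endpoints of $X$, and these do not belong to $\Delta_f$. Put $\widetilde X_f:=\bigcap_{n\ge0}f^{-n}(X\setminus\Delta_f)$. **Entropy.** A collection of $X$ is a set $\mathcal C$ of non-empty subsets of $X$. Put $f^{-j}(\mathcal C):=\{f^{-j}(C):C\in\mathcal C\}\setminus\{\emptyset\}$, $\mathcal C\setminus F:=\{C\setminus F:C\in\mathcal C\}\setminus\{\emptyset\}$, $\bigvee_{j}\mathcal C_j:=\{\bigcap_jC_j: C_j\in\mathcal C_j\ \forall j\}\setminus\{\emptyset\}$, and $\mathcal C^n:=\bigvee_{j=0}^{n-1}f^{-j}(\mathcal C\setminus\Delta_f)$. For non-empty $B$ and a cover $\mathcal C$ of $B$,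 $\aleph_B(\mathcal C)$ is the least cardinality of a sub-collection of $\mathcal C$ covering $B$. Then $$h_{top}(f,\mathcal C):=\lim_{n\to\infty}\frac{\log\aleph_{\widetilde X_f}(\mathcal C^n)}{n},\qquad h_{top}(f):=\sup\{h_{top}(f,\mathcal C):\mathcal C\text{ is an open cover of }X\}.$$ *)

theory Defs
  imports "HOL-Analysis.Analysis" "HOL-Library.Disjoint_Sets"
begin

section \<open>Piecewise continuous interval maps\<close>

text \<open>
  The pieces are given as a family \<open>P\<close>, of which only \<open>P 1, \<dots>, P N\<close> matter.
  All topological notions are relative to \<open>X\<close>, i.e. taken in \<open>top_of_set X\<close>.
  Only the values of \<open>f\<close> on \<open>X\<close> are relevant.
\<close>

definition critical_point :: "real set \<Rightarrow> (real \<Rightarrow> real) \<Rightarrow> real \<Rightarrow> bool" where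
  "critical_point X f x \<longleftrightarrow>
     x \<in> X \<and>
     (\<not> (\<exists>U. openin (top_of_set X) U \<and> x \<in> U \<and> inj_on f U) \<or>
      \<not> continuous (at x within X) f)"

definition boundary_points :: "real set \<Rightarrow> nat \<Rightarrow> (nat \<Rightarrow> real set) \<Rightarrow> real set" where
  "boundary_points X N P = (\<Union>i\<in>{1..N}. top_of_set X frontier_of P i)"

text \<open>
  The last assumption is the convention on the end points \<open>Inf X\<close> and \<open>Sup X\<close> of \<open>X\<close>.
  It forces them to lie in the first and the last piece, respectively.
\<close>

definition pc_map :: "real set \<Rightarrow> (real \<Rightarrow> real) \<Rightarrow> nat \<Rightarrow> (nat \<Rightarrow> real set) \<Rightarrow> bool" where
  "pc_map X f N P \<longleftrightarrow>
     is_interval X \<and> compact X \<and> interior X \<noteq> {} \<and>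
     f \<in> X \<rightarrow> X \<and>
     N \<ge> 1 \<and>
     (\<forall>i\<in>{1..N}. P i \<noteq> {} \<and> is_interval (P i) \<and> openin (top_of_set X) (P i)) \<and>
     disjoint_family_on P {1..N} \<and>
     X = (\<Union>i\<in>{1..N}. top_of_set X closure_of P i) \<and>
     (\<forall>i\<in>{1..N}. continuous_on (P i) f) \<and>
     (\<forall>i\<in>{1..N}. finite {x \<in> P i. critical_point X f x}) \<and>
     (\<forall>i\<in>{1..N}. \<forall>j\<in>{1..N}. i < j \<longrightarrow> (\<forall>x\<in>P i. \<forall>y\<in>P j. x < y)) \<and>
     (\<forall>e\<in>{Inf X, Sup X}. continuous (at e within X) f \<and> e \<notin> boundary_points X N P)"


section \<open>Topological entropy\<close>

definition preimage :: "'a set \<Rightarrow> ('a \<Rightarrow> 'a) \<Rightarrow> nat \<Rightarrow> 'a set \<Rightarrow> 'a set" where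
  "preimage X f n A = {x \<in> X. (f ^^ n) x \<in> A}"

definition regular_points :: "'a set \<Rightarrow> ('a \<Rightarrow> 'a) \<Rightarrow> 'a set \<Rightarrow> 'a set" where
  "regular_points X f \<Delta> = (\<Inter>n. preimage X f n (X - \<Delta>))"

definition preimage_coll :: "'a set \<Rightarrow> ('a \<Rightarrow> 'a) \<Rightarrow> nat \<Rightarrow> 'a set set \<Rightarrow> 'a set set" where
  "preimage_coll X f j \<C> = {preimage X f j C | C. C \<in> \<C>} - {{}}"

definition remove_coll :: "'a set set \<Rightarrow> 'a set \<Rightarrow> 'a set set" where
  "remove_coll \<C> F = {C - F | C. C \<in> \<C>} - {{}}"

definition join_coll :: "'i set \<Rightarrow> ('i \<Rightarrow> 'a set set) \<Rightarrow> 'a set set" where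
  "join_coll I \<C> = {\<Inter>j\<in>I. C j | C. \<forall>j\<in>I. C j \<in> \<C> j} - {{}}"

definition iterated_coll ::
  "'a set \<Rightarrow> ('a \<Rightarrow> 'a) \<Rightarrow> 'a set \<Rightarrow> 'a set set \<Rightarrow> nat \<Rightarrow> 'a set set" where
  "iterated_coll X f \<Delta> \<C> n = join_coll {0..<n} (\<lambda>j. preimage_coll X f j (remove_coll \<C> \<Delta>))"

text \<open>
  The least cardinality of a subcover, as a natural number. It is meaningful only if \<open>\<C>\<close> has a
  finite subcover of \<open>B\<close>. This is the case for \<open>iterated_coll X f \<Delta> \<C> n\<close> and
  \<open>regular_points X f \<Delta>\<close> whenever \<open>\<C>\<close> is an open cover of a compact set \<open>X\<close> and \<open>f\<close> maps \<open>X\<close>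
  to itself: a finite subcover of \<open>\<C>\<close> induces a finite subcover of \<open>iterated_coll X f \<Delta> \<C> n\<close>.
\<close>

definition min_subcover :: "'a set \<Rightarrow> 'a set set \<Rightarrow> nat" where
  "min_subcover B \<C> = (LEAST k. \<exists>\<D>\<subseteq>\<C>. finite \<D> \<and> B \<subseteq> \<Union>\<D> \<and> card \<D> = k)"

definition open_cover :: "'a::topological_space set \<Rightarrow> 'a set set \<Rightarrow> bool" where
  "open_cover X \<C> \<longleftrightarrow> (\<forall>C\<in>\<C>. C \<noteq> {} \<and> openin (top_of_set X) C) \<and> \<Union>\<C> = X"

definition h_top_cover :: "'a set \<Rightarrow> ('a \<Rightarrow> 'a) \<Rightarrow> 'a set \<Rightarrow> 'a set set \<Rightarrow> ereal" where
  "h_top_cover X f \<Delta> \<C> =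
     lim (\<lambda>n. ereal (ln (real (min_subcover (regular_points X f \<Delta>) (iterated_coll X f \<Delta> \<C> n)))
                     / real n))"

definition h_top ::
  "real set \<Rightarrow> (real \<Rightarrow> real) \<Rightarrow> nat \<Rightarrow> (nat \<Rightarrow> real set) \<Rightarrow> ereal" where
  "h_top X f N P = (SUP \<C>\<in>{\<C>. open_cover X \<C>}. h_top_cover X f (boundary_points X N P) \<C>)"

end

theory Submission imports Defs "HOL-Real_Asymp.Real_Asymp" begin

text \<open>
  Write \<open>\<Delta>\<close> for the boundary points of the pieces. Fix an open cover \<open>\<C>\<close> of \<open>X\<close>. By compactness,
  \<open>\<Delta>\<close> can be enlarged to a finite set \<open>F\<close> such that every interval in \<open>X\<close> that avoids \<open>F\<close> lies in
  a single member of \<open>\<C>\<close> (\<open>open_cover_cut_points\<close>). Let \<open>E\<close> be the set of points whose orbit hits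
  \<open>F\<close> at a time \<open>j < n\<close> without having met \<open>\<Delta>\<close> before. On the points that have not met \<open>\<Delta>\<close> before
  time \<open>j\<close>, the iterate \<open>f\<^sup>j\<close> is injective, so each time contributes at most \<open>card F\<close> points and
  \<open>E\<close> has at most \<open>n * card F\<close> elements. This is where injectivity prevents exponential growth
  (\<open>hitting_points_bound\<close>).

  The points of \<open>E\<close> cut \<open>X\<close> into at most \<open>2 * card E + 1\<close> sets: the points themselves and the
  intervals between neighbours. On such an interval the first \<open>n\<close> iterates are continuous and their
  images are intervals that avoid \<open>F\<close>, hence each image lies in one member of \<open>\<C>\<close>. Thus each of the
  cut sets meets the regular points in a subset of one element of the \<open>n\<close>-th iterated cover
  (\<open>min_subcover_iterated_coll_le\<close>). The minimal subcovers therefore grow at most linearly in \<open>n\<close>,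
  and their exponential growth rate is zero.
\<close>

section \<open>Orbits that avoid the discontinuities\<close>

lemma inj_on_funpow:
  assumes "inj_on f Y"
  shows "inj_on (f ^^ j) {x. \<forall>i<j. (f ^^ i) x \<in> Y}"
proof (induction j)
  case 0
  then show ?case by simp
next
  case (Suc j)
  show ?case
  proof (rule inj_onI)
    fix x y
    assume x: "x \<in> {x. \<forall>i<Suc j. (f ^^ i) x \<in> Y}" and y: "y \<in> {x. \<forall>i<Suc j. (f ^^ i) x \<in> Y}"
      and eq: "(f ^^ Suc j) x = (f ^^ Suc j) y"
    have "(f ^^ j) x = (f ^^ j) y"
      using eq x y assms by (auto dest: inj_onD)
    with Suc.IH show "x = y"
      using x y by (auto dest!: inj_onD)
  qed
qed

lemma continuous_on_funpow:
  fixes f :: "'a::topological_space \<Rightarrow> 'a"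
  assumes "continuous_on Y f" and "\<And>i. i < j \<Longrightarrow> (f ^^ i) ` K \<subseteq> Y"
  shows "continuous_on K (f ^^ j)"
  using assms(2)
proof (induction j)
  case 0
  show ?case by (simp add: id_def)
next
  case (Suc j)
  have "continuous_on K (f \<circ> (f ^^ j))"
  proof (rule continuous_on_compose)
    show "continuous_on K (f ^^ j)" using Suc by simp
    show "continuous_on ((f ^^ j) ` K) f"
      using assms(1) Suc.prems[of j] by (blast intro: continuous_on_subset)
  qed
  then show ?case by simp
qed

lemma funpow_mem: "f \<in> X \<rightarrow> X \<Longrightarrow> x \<in> X \<Longrightarrow> (f ^^ j) x \<in> X"
  by (induction j) auto

text \<open>
  The orbit has to stay in \<open>Y\<close> before it hits \<open>F\<close>, since only on \<open>Y\<close> is \<open>f\<close> under control. With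
  \<open>Y = X - \<Delta>\<close> and \<open>\<Delta> \<subseteq> F\<close> this restriction loses nothing: an orbit that leaves \<open>Y\<close> does so through
  a point of \<open>F\<close>, and is recorded at that moment.
\<close>

definition hitting_points :: "'a set \<Rightarrow> ('a \<Rightarrow> 'a) \<Rightarrow> 'a set \<Rightarrow> nat \<Rightarrow> 'a set" where
  "hitting_points Y f F n = (\<Union>j<n. {x. (\<forall>i<j. (f ^^ i) x \<in> Y) \<and> (f ^^ j) x \<in> F})"

lemma hitting_points_bound:
  assumes "inj_on f Y" and "finite F"
  shows "finite (hitting_points Y f F n)" and "card (hitting_points Y f F n) \<le> n * card F"
proof -
  define H where "H j = {x. (\<forall>i<j. (f ^^ i) x \<in> Y) \<and> (f ^^ j) x \<in> F}" for j
  have inj: "inj_on (f ^^ j) (H j)" for j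
    by (rule inj_on_subset[OF inj_on_funpow[OF assms(1)]]) (auto simp: H_def)
  have img: "(f ^^ j) ` H j \<subseteq> F" for j by (auto simp: H_def)
  have fin: "finite (H j)" for j
    using inj_on_finite[OF inj img assms(2)] .
  have card: "card (H j) \<le> card F" for j
    using card_inj_on_le[OF inj img assms(2)] .
  have eq: "hitting_points Y f F n = (\<Union>j<n. H j)" by (simp add: hitting_points_def H_def)
  show "finite (hitting_points Y f F n)" by (simp add: eq fin)
  have "card (\<Union>j<n. H j) \<le> (\<Sum>j<n. card (H j))" by (rule card_UN_le) simp
  also have "\<dots> \<le> (\<Sum>j<n. card F)" by (intro sum_mono card)
  finally show "card (hitting_points Y f F n) \<le> n * card F" by (simp add: eq)
qed

lemma not_hitting_pointsD:
  assumes "f \<in> X \<rightarrow> X" and "\<Delta> \<subseteq> F" and "x \<in> X" and "x \<notin> hitting_points (X - \<Delta>) f F n" and "j < n"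
  shows "(f ^^ j) x \<in> X - F"
  using \<open>j < n\<close>
proof (induction j rule: less_induct)
  case (less j)
  then have "\<forall>i<j. (f ^^ i) x \<in> X - \<Delta>" using assms(2) by auto
  then have "(f ^^ j) x \<notin> F" using assms(4) less.prems by (auto simp: hitting_points_def)
  then show ?case using funpow_mem[OF assms(1,3)] by auto
qed

section \<open>Cutting an interval at finitely many points\<close>

lemma connected_subset_greaterThanLessThan:
  fixes S :: "real set"
  assumes "connected S" and "a \<notin> S" and "b \<notin> S" and "s \<in> S" and "s \<in> {a<..<b}"
  shows "S \<subseteq> {a<..<b}"
proof
  fix t assume t: "t \<in> S"
  have "is_interval S" using assms(1) by (simp add: is_interval_connected_1)
  then have "a < t" "t < b"
    using t assms(2-5) by (smt (verit) greaterThanLessThan_iff mem_is_interval_1_I)+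
  then show "t \<in> {a<..<b}" by simp
qed

text \<open>
  Around each point choose an open interval whose trace on \<open>X\<close> lies in a member of the cover;
  finitely many of them cover \<open>X\<close>. Their end points serve as cut points: a connected set that
  avoids them cannot leave an interval that it meets.
\<close>

lemma open_cover_cut_points:
  fixes X :: "real set"
  assumes "compact X" and "open_cover X \<C>"
  obtains G where "finite G"
    and "\<And>S. connected S \<Longrightarrow> S \<subseteq> X \<Longrightarrow> S \<inter> G = {} \<Longrightarrow> S \<noteq> {} \<Longrightarrow> \<exists>C\<in>\<C>. S \<subseteq> C"
proof -
  have "\<exists>r>0. \<exists>C\<in>\<C>. X \<inter> {x - r<..<x + r} \<subseteq> C" if "x \<in> X" for x
  proof -
    from that assms(2) obtain C where C: "C \<in> \<C>" "x \<in> C" "openin (top_of_set X) C"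
      by (auto simp: open_cover_def)
    then obtain r where "r > 0" "ball x r \<inter> X \<subseteq> C"
      using openin_contains_ball by metis
    then show ?thesis using C(1)
      by (auto intro!: exI[of _ r] bexI[of _ C] simp: ball_eq_greaterThanLessThan)
  qed
  then obtain r where r: "\<And>x. x \<in> X \<Longrightarrow> r x > (0::real)"
      "\<And>x. x \<in> X \<Longrightarrow> \<exists>C\<in>\<C>. X \<inter> {x - r x<..<x + r x} \<subseteq> C"
    by metis
  have "X \<subseteq> (\<Union>x\<in>X. {x - r x<..<x + r x})" using r(1) by force
  then obtain Z where Z: "Z \<subseteq> X" "finite Z" "X \<subseteq> (\<Union>x\<in>Z. {x - r x<..<x + r x})"
    using compactE_image[OF assms(1), of X "\<lambda>x. {x - r x<..<x + r x}"] by auto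
  show thesis
  proof
    show "finite ((\<lambda>x. x - r x) ` Z \<union> (\<lambda>x. x + r x) ` Z)" using Z(2) by simp
    fix S assume S: "connected S" "S \<subseteq> X" "S \<inter> ((\<lambda>x. x - r x) ` Z \<union> (\<lambda>x. x + r x) ` Z) = {}" "S \<noteq> {}"
    then obtain s z where sz: "s \<in> S" "z \<in> Z" "s \<in> {z - r z<..<z + r z}" using Z(3) by fast
    have "S \<subseteq> {z - r z<..<z + r z}"
      by (rule connected_subset_greaterThanLessThan[OF S(1) _ _ sz(1,3)]) (use S(3) sz(2) in blast)+
    then show "\<exists>C\<in>\<C>. S \<subseteq> C" using r(2)[of z] sz(2) Z(1) S(2) by blast
  qed
qed

text \<open>
  Let \<open>E\<close> be finite. At a point of \<open>E\<close> that has \<open>k\<close> smaller elements of \<open>E\<close> the value is \<open>2 * k + 1\<close>; at a point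
  outside \<open>E\<close> with \<open>k\<close> smaller elements it is \<open>2 * k\<close>. The fibres of this monotone function are therefore the elements of
  \<open>E\<close> and the gaps between them, including the two unbounded ones.
\<close>

definition gap_index :: "real set \<Rightarrow> real \<Rightarrow> nat" where
  "gap_index E x = card (E \<inter> {..<x}) + card (E \<inter> {..x})"

lemma gap_index_le: "finite E \<Longrightarrow> gap_index E x \<le> 2 * card E"
  unfolding gap_index_def
  using card_mono[of E "E \<inter> {..<x}"] card_mono[of E "E \<inter> {..x}"] by auto

lemma gap_index_mono: "finite E \<Longrightarrow> x \<le> y \<Longrightarrow> gap_index E x \<le> gap_index E y"
  unfolding gap_index_def by (intro add_mono card_mono) auto

lemma gap_index_less:
  assumes "finite E" and "x < y" and "e \<in> E" and "e \<in> {x..y}"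
  shows "gap_index E x < gap_index E y"
proof -
  have le: "card (E \<inter> {..<x}) \<le> card (E \<inter> {..<y})" "card (E \<inter> {..x}) \<le> card (E \<inter> {..y})"
    using assms by (intro card_mono; force)+
  have "card (E \<inter> {..<x}) < card (E \<inter> {..<y}) \<or> card (E \<inter> {..x}) < card (E \<inter> {..y})"
  proof (cases "e < y")
    case True
    then have "e \<in> E \<inter> {..<y}" "e \<notin> E \<inter> {..<x}" "E \<inter> {..<x} \<subseteq> E \<inter> {..<y}"
      using assms(2-4) by auto
    then have "E \<inter> {..<x} \<subset> E \<inter> {..<y}" by blast
    then show ?thesis using assms(1) by (simp add: psubset_card_mono)
  next
    case False
    then have "e \<in> E \<inter> {..y}" "e \<notin> E \<inter> {..x}" "E \<inter> {..x} \<subseteq> E \<inter> {..y}"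
      using assms(2-4) by auto
    then have "E \<inter> {..x} \<subset> E \<inter> {..y}" by blast
    then show ?thesis using assms(1) by (simp add: psubset_card_mono)
  qed
  with le show ?thesis by (auto simp: gap_index_def)
qed

section \<open>Linear growth of minimal subcovers\<close>

lemma min_subcover_le:
  assumes "finite I" and "\<And>i. i \<in> I \<Longrightarrow> \<exists>A\<in>\<A>. {x \<in> B. g x = i} \<subseteq> A" and "g ` B \<subseteq> I"
  shows "min_subcover B \<A> \<le> card I"
proof -
  obtain A where A: "\<And>i. i \<in> I \<Longrightarrow> A i \<in> \<A> \<and> {x \<in> B. g x = i} \<subseteq> A i"
    using assms(2) by metis
  have "min_subcover B \<A> \<le> card (A ` I)"
    unfolding min_subcover_def using assms(1,3) A
    by (intro Least_le exI[of _ "A ` I"]) blast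
  then show ?thesis using card_image_le[OF assms(1), of A] by linarith
qed

text \<open>The point \<open>x\<close> keeps the constructed sets from being empty, as empty sets are left out of joins.\<close>

lemma iterated_coll_mem:
  assumes "x \<in> B" and "B \<subseteq> regular_points X f \<Delta>"
    and "\<And>j. j < n \<Longrightarrow> \<exists>C\<in>\<C>. (f ^^ j) ` B \<subseteq> C"
  shows "\<exists>A\<in>iterated_coll X f \<Delta> \<C> n. B \<subseteq> A"
proof -
  obtain C where C: "\<And>j. j < n \<Longrightarrow> C j \<in> \<C> \<and> (f ^^ j) ` B \<subseteq> C j" using assms(3) by metis
  define A where "A j = preimage X f j (C j - \<Delta>)" for j
  have BA: "B \<subseteq> A j" if "j < n" for j
  proof
    fix y assume y: "y \<in> B"
    then have "y \<in> preimage X f j (X - \<Delta>)" using assms(2) by (auto simp: regular_points_def)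
    moreover have "(f ^^ j) y \<in> C j" using C[OF that] y by blast
    ultimately show "y \<in> A j" by (simp add: A_def preimage_def)
  qed
  have "A j \<in> preimage_coll X f j (remove_coll \<C> \<Delta>)" if "j < n" for j
  proof -
    have "x \<in> A j" using BA[OF that] assms(1) by blast
    then have "A j \<noteq> {}" "C j - \<Delta> \<noteq> {}" by (auto simp: A_def preimage_def)
    then show ?thesis
      using C[OF that] unfolding preimage_coll_def remove_coll_def A_def by blast
  qed
  moreover have "B \<subseteq> (\<Inter>j\<in>{0..<n}. A j)" by (rule INF_greatest) (simp add: BA)
  moreover from this assms(1) have "(\<Inter>j\<in>{0..<n}. A j) \<noteq> {}" by blast
  ultimately have "(\<Inter>j\<in>{0..<n}. A j) \<in> iterated_coll X f \<Delta> \<C> n"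
    unfolding iterated_coll_def join_coll_def
    by (intro DiffI CollectI exI[of _ A]) simp_all
  then show ?thesis using \<open>B \<subseteq> (\<Inter>j\<in>{0..<n}. A j)\<close> by blast
qed

text \<open>
  The fibres of \<open>gap_index\<close> for the hitting points index a subcover. A fibre \<open>K\<close> is treated inside
  all of \<open>X\<close> rather than among the regular points, because only there is it an interval, which makes
  its images connected.
\<close>

lemma min_subcover_iterated_coll_le:
  fixes X :: "real set"
  assumes X: "is_interval X" and f: "f \<in> X \<rightarrow> X"
    and cont: "continuous_on (X - \<Delta>) f" and inj: "inj_on f (X - \<Delta>)"
    and F: "finite F" "\<Delta> \<subseteq> F" and cov: "X \<subseteq> \<Union>\<C>"
    and cut: "\<And>S. connected S \<Longrightarrow> S \<subseteq> X \<Longrightarrow> S \<inter> F = {} \<Longrightarrow> S \<noteq> {} \<Longrightarrow> \<exists>C\<in>\<C>. S \<subseteq> C"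
  shows "min_subcover (regular_points X f \<Delta>) (iterated_coll X f \<Delta> \<C> n) \<le> 2 * (n * card F) + 1"
proof -
  define E where "E = hitting_points (X - \<Delta>) f F n"
  have finE: "finite E" and cardE: "card E \<le> n * card F"
    using hitting_points_bound[OF inj F(1)] by (simp_all add: E_def)
  define R where "R = regular_points X f \<Delta>"
  have RX: "R \<subseteq> X" by (auto simp: R_def regular_points_def preimage_def)
  have "min_subcover R (iterated_coll X f \<Delta> \<C> n) \<le> card (gap_index E ` R)"
  proof (rule min_subcover_le)
    show "finite (gap_index E ` R)"
      using gap_index_le[OF finE] by (auto intro!: finite_subset[of _ "{..2 * card E}"])
    fix k assume "k \<in> gap_index E ` R"
    then obtain x where x: "x \<in> R" "gap_index E x = k" by auto
    define K where "K = {y \<in> X. gap_index E y = k}"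
    have xK: "x \<in> K" using x RX by (auto simp: K_def)
    \<comment> \<open>On a single point the images are trivially small; otherwise the orbits of \<open>K\<close> avoid \<open>F\<close>.\<close>
    have fibre: "K \<inter> E = {} \<or> K = {x}"
    proof (rule ccontr)
      assume "\<not> (K \<inter> E = {} \<or> K = {x})"
      then obtain e y where "e \<in> K" "e \<in> E" "y \<in> K" "y \<noteq> e" using xK by blast
      moreover have "gap_index E y = gap_index E e" using \<open>e \<in> K\<close> \<open>y \<in> K\<close> by (simp add: K_def)
      ultimately show False
        using gap_index_less[OF finE, of y e e] gap_index_less[OF finE, of e y e]
        by (cases y e rule: linorder_cases) auto
    qed
    have "is_interval K"
      unfolding is_interval_1
    proof (intro ballI allI impI)
      fix a b c assume abc: "a \<in> K" "b \<in> K" "a \<le> c \<and> c \<le> b"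
      then have "c \<in> X" using X by (auto simp: K_def is_interval_1)
      moreover have "gap_index E c = k"
        using abc gap_index_mono[OF finE, of a c] gap_index_mono[OF finE, of c b]
        by (auto simp: K_def)
      ultimately show "c \<in> K" by (simp add: K_def)
    qed
    then have "connected K" by (simp add: is_interval_connected_1)
    have image_K: "\<exists>C\<in>\<C>. (f ^^ j) ` K \<subseteq> C" if "j < n" for j
      using fibre
    proof
      assume "K = {x}"
      then show ?thesis using cov funpow_mem[OF f, of x j] x(1) RX by auto
    next
      assume KE: "K \<inter> E = {}"
      have orbit: "(f ^^ i) ` K \<subseteq> X - F" if "i < n" for i
        using not_hitting_pointsD[OF f F(2) _ _ that] KE by (auto simp: K_def E_def)
      have "continuous_on K (f ^^ j)"
      proof (rule continuous_on_funpow[OF cont])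
        fix i assume "i < j"
        then have "(f ^^ i) ` K \<subseteq> X - F" using orbit \<open>j < n\<close> by simp
        then show "(f ^^ i) ` K \<subseteq> X - \<Delta>" using F(2) by blast
      qed
      then have "connected ((f ^^ j) ` K)"
        using \<open>connected K\<close> by (rule connected_continuous_image)
      then show ?thesis
        using cut[of "(f ^^ j) ` K"] orbit[OF \<open>j < n\<close>] xK by blast
    qed
    show "\<exists>A\<in>iterated_coll X f \<Delta> \<C> n. {y \<in> R. gap_index E y = k} \<subseteq> A"
    proof (rule iterated_coll_mem)
      show "x \<in> {y \<in> R. gap_index E y = k}" using x by simp
      show "{y \<in> R. gap_index E y = k} \<subseteq> regular_points X f \<Delta>" by (auto simp: R_def)
      have "{y \<in> R. gap_index E y = k} \<subseteq> K" using RX by (auto simp: K_def)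
      then show "\<exists>C\<in>\<C>. (f ^^ j) ` {y \<in> R. gap_index E y = k} \<subseteq> C" if "j < n" for j
        using image_K[OF that] by (meson image_mono subset_trans)
    qed
  qed simp
  also have "\<dots> \<le> card {..2 * card E}"
    using gap_index_le[OF finE] by (intro card_mono) auto
  also have "\<dots> \<le> 2 * (n * card F) + 1" using cardE by simp
  finally show ?thesis by (simp add: R_def)
qed

section \<open>Vanishing entropy\<close>

text \<open>The value \<open>a n = 0\<close> is harmless since \<open>ln 0 = 0\<close>.\<close>

lemma linear_growth_imp_ln_over_n_tendsto_0:
  fixes a :: "nat \<Rightarrow> nat"
  assumes "\<And>n. a n \<le> c * n + 1"
  shows "(\<lambda>n. ln (real (a n)) / real n) \<longlonglongrightarrow> 0"
proof (rule tendsto_sandwich)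
  show "\<forall>\<^sub>F n in sequentially. 0 \<le> ln (real (a n)) / real n"
  proof (intro always_eventually allI)
    show "0 \<le> ln (real (a n)) / real n" for n by (cases "a n = 0") auto
  qed
  show "\<forall>\<^sub>F n in sequentially. ln (real (a n)) / real n \<le> ln (real (Suc c) * real n + 1) / real n"
  proof (intro always_eventually allI divide_right_mono)
    fix n
    have "real (a n) \<le> real (c * n + 1)" using assms[of n] by (simp only: of_nat_le_iff)
    then have "real (a n) \<le> real (Suc c) * real n + 1" by (simp add: algebra_simps)
    then show "ln (real (a n)) \<le> ln (real (Suc c) * real n + 1)"
      by (cases "a n = 0") auto
  qed simp
  \<comment> \<open>The slope is \<open>Suc c\<close> rather than \<open>c\<close> to make it positive also for \<open>c = 0\<close>.\<close>
  have "real (Suc c) > 0" by simp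
  then show "(\<lambda>n. ln (real (Suc c) * real n + 1) / real n) \<longlonglongrightarrow> 0"
    by real_asymp
qed simp

lemma h_top_cover_eq_0:
  fixes X :: "real set"
  assumes "is_interval X" and "compact X" and "f \<in> X \<rightarrow> X" and "finite \<Delta>"
    and "continuous_on (X - \<Delta>) f" and "inj_on f (X - \<Delta>)" and "open_cover X \<C>"
  shows "h_top_cover X f \<Delta> \<C> = 0"
proof -
  obtain G where G: "finite G"
    "\<And>S. connected S \<Longrightarrow> S \<subseteq> X \<Longrightarrow> S \<inter> G = {} \<Longrightarrow> S \<noteq> {} \<Longrightarrow> \<exists>C\<in>\<C>. S \<subseteq> C"
    using open_cover_cut_points[OF assms(2,7)] by blast
  have "min_subcover (regular_points X f \<Delta>) (iterated_coll X f \<Delta> \<C> n)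
      \<le> 2 * (n * card (\<Delta> \<union> G)) + 1" for n
  proof (rule min_subcover_iterated_coll_le[OF assms(1,3,5,6)])
    show "finite (\<Delta> \<union> G)" using assms(4) G(1) by simp
    show "X \<subseteq> \<Union>\<C>" using assms(7) by (simp add: open_cover_def)
    show "\<exists>C\<in>\<C>. S \<subseteq> C" if "connected S" "S \<subseteq> X" "S \<inter> (\<Delta> \<union> G) = {}" "S \<noteq> {}" for S
      using G(2)[of S] that by blast
  qed simp
  then have "min_subcover (regular_points X f \<Delta>) (iterated_coll X f \<Delta> \<C> n)
      \<le> 2 * card (\<Delta> \<union> G) * n + 1" for n
    by (simp add: algebra_simps)
  from tendsto_ereal[OF linear_growth_imp_ln_over_n_tendsto_0[OF this]] show ?thesis
    unfolding h_top_cover_def zero_ereal_def by (rule limI)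
qed

section \<open>Injective piecewise continuous maps\<close>

lemma pc_map_complement_boundary:
  assumes "pc_map X f N P"
  shows "X - boundary_points X N P \<subseteq> (\<Union>i\<in>{1..N}. P i)"
proof
  fix x assume x: "x \<in> X - boundary_points X N P"
  have "X = (\<Union>i\<in>{1..N}. top_of_set X closure_of P i)" using assms by (simp add: pc_map_def)
  then obtain i where i: "i \<in> {1..N}" "x \<in> top_of_set X closure_of P i" using x by blast
  moreover have "x \<notin> top_of_set X frontier_of P i"
    using x i by (auto simp: boundary_points_def)
  ultimately have "x \<in> top_of_set X interior_of P i" by (auto simp: frontier_of_def)
  then show "x \<in> (\<Union>i\<in>{1..N}. P i)" using i(1) interior_of_subset by fastforce
qed

lemma pc_map_continuous_on:
  assumes "pc_map X f N P"
  shows "continuous_on (\<Union>i\<in>{1..N}. P i) f"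
  unfolding continuous_on_eq_continuous_within
proof
  fix x assume "x \<in> (\<Union>i\<in>{1..N}. P i)"
  then obtain i where i: "i \<in> {1..N}" "x \<in> P i" by blast
  then have "openin (top_of_set X) (P i)" and cont: "continuous_on (P i) f"
    using assms by (auto simp: pc_map_def)
  then obtain U where U: "open U" "P i = X \<inter> U" by (auto simp: openin_open)
  have "P j \<subseteq> X" if "j \<in> {1..N}" for j
    using assms that by (intro openin_imp_subset[of euclidean]) (simp add: pc_map_def)
  then have "U \<inter> (\<Union>i\<in>{1..N}. P i) = U \<inter> P i"
    using U(2) i(1) by blast
  then have "at x within (\<Union>i\<in>{1..N}. P i) = at x within P i"
    using U(1,2) i(2) by (intro at_within_nhd[of x U]) auto
  then show "continuous (at x within (\<Union>i\<in>{1..N}. P i)) f"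
    using cont i(2) by (simp add: continuous_on_eq_continuous_within)
qed

text \<open>A missing limit point of an interval lies below or above all of it.\<close>

lemma closure_diff_is_interval_subset:
  fixes I :: "real set"
  assumes "is_interval I"
  shows "closure I - I \<subseteq> {Inf I, Sup I}"
proof
  fix x assume x: "x \<in> closure I - I"
  have "(\<forall>y\<in>I. x < y) \<or> (\<forall>y\<in>I. y < x)"
    using assms x unfolding is_interval_1 by (metis DiffD2 linorder_le_less_linear less_imp_le)
  then show "x \<in> {Inf I, Sup I}"
  proof
    assume lt: "\<forall>y\<in>I. x < y"
    have "Inf I = x"
    proof (rule cInf_eq_non_empty)
      show "I \<noteq> {}" using x by auto
      show "x \<le> y" if "y \<in> I" for y using lt that by auto
      fix y assume "\<And>z. z \<in> I \<Longrightarrow> y \<le> z"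
      then have "closure I \<subseteq> {y..}" by (intro closure_minimal) auto
      then show "y \<le> x" using x by auto
    qed
    then show ?thesis by simp
  next
    assume lt: "\<forall>y\<in>I. y < x"
    have "Sup I = x"
    proof (rule cSup_eq_non_empty)
      show "I \<noteq> {}" using x by auto
      show "y \<le> x" if "y \<in> I" for y using lt that by auto
      fix y assume "\<And>z. z \<in> I \<Longrightarrow> z \<le> y"
      then have "closure I \<subseteq> {..y}" by (intro closure_minimal) auto
      then show "x \<le> y" using x by auto
    qed
    then show ?thesis by simp
  qed
qed

lemma finite_boundary_points:
  assumes "pc_map X f N P"
  shows "finite (boundary_points X N P)"
  unfolding boundary_points_def
proof (intro finite_UN_I)
  fix i assume i: "i \<in> {1..N}"
  then have I: "is_interval (P i)" "openin (top_of_set X) (P i)"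
    using assms by (auto simp: pc_map_def)
  have "top_of_set X frontier_of P i \<subseteq> closure (P i) - P i"
    using I(2) closure_mono[of "X \<inter> P i" "P i"]
    by (auto simp: frontier_of_def closure_of_subtopology interior_of_openin)
  then show "finite (top_of_set X frontier_of P i)"
    using closure_diff_is_interval_subset[OF I(1)] by (meson finite.emptyI finite_insert finite_subset)
qed simp

theorem corollary2p7:
  fixes X :: "real set" and f :: "real \<Rightarrow> real" and N :: nat and P :: "nat \<Rightarrow> real set"
  assumes "pc_map X f N P"
    and "inj_on f (\<Union>i\<in>{1..N}. P i)"
  shows "h_top X f N P = 0"
proof -
  have X: "is_interval X" "compact X" "interior X \<noteq> {}" "f \<in> X \<rightarrow> X"
    using assms(1) by (auto simp: pc_map_def)
  have sub: "X - boundary_points X N P \<subseteq> (\<Union>i\<in>{1..N}. P i)"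
    by (rule pc_map_complement_boundary[OF assms(1)])
  have "h_top_cover X f (boundary_points X N P) \<C> = 0" if "open_cover X \<C>" for \<C>
    by (rule h_top_cover_eq_0[OF X(1,2,4) finite_boundary_points[OF assms(1)]
          continuous_on_subset[OF pc_map_continuous_on[OF assms(1)] sub]
          inj_on_subset[OF assms(2) sub] that])
  moreover have "X \<noteq> {}" using X(3) by auto
  then have "open_cover X {X}" by (simp add: open_cover_def)
  ultimately show ?thesis
    unfolding h_top_def by (intro antisym SUP_least) (auto intro!: SUP_upper2[of "{X}"])
qed

end
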